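(* For $n\ge1$ let $\mathcal{X}_n=\mathbb{Z}_{n+1}$ (integers modulo $n+1$), let $K_n$ be the transition matrix of the simple random walk on the cycle $\mathbb{Z}_{n+1}$ (from $x$, move to $x+1$ or to $x-1$ modulo $n+1$ with probability $1/2$ each), let $\pi_n$ be its stationary (uniform) distribution, and let $p_n=n^2\exp\{-n^\gamma\}$ with $\gamma>0$. Let $\mathcal{F}^{\mathcal{P}}$ be the family whose $n$th chain is the product of $(\mathcal{X}_i,K_i,\pi_i)_{i=1}^n$ according to the probability vector $(p_1/q_n,\dots,p_n/q_n)$, $q_n=p_1+\cdots+p_n$. If $\gamma>1$, then $\mathcal{F}^{\mathcal{P}}_c$ has no cutoff in the total variation.
   Context: Product chain of $(\mathcal{X}_i,K_i,\pi_i)_{i=1}^n$ according to a probability vector $(w_1,\dots,w_n)$ with positive entries: state space $\prod_i\mathcal{X}_i$, stationary distribution $\pi_1\times\cdots\times\pi_n$, transition matrix $\sum_{i=1}^nw_i\,I_1\otimes\cdots\otimes I_{i-1}\otimes K_i\otimes I_{i+1}\otimes\cdots\otimes I_n$. $\mathcal{F}^{\mathcal{P}}_c$ is the family of associated continuous time chains: if the $n$th chain of $\mathcal{F}^{\mathcal{P}}$ is $(\mathcal{Y}_n,L_n,\nu_n)$, its continuous time version has transition matrices $\widetilde{H}_{n,t}=e^{-t(I-L_n)}$, $t\ge0$. Let $d^{(c)}_{n,\mathrm{TV}}(t)=\sup_{y\in\mathcal{Y}_n,A\subset\mathcal{Y}_n}\{\widetilde{H}_{n,t}(y,A)-\nu_n(A)\}$.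 The family has a total variation cutoff if there are $t_n>0$ such that $d^{(c)}_{n,\mathrm{TV}}(at_n)\to0$ for all $a>1$ and $d^{(c)}_{n,\mathrm{TV}}(at_n)\to1$ for all $a\in(0,1)$. *)

theory Defs
  imports Complex_Main "HOL-Library.FuncSet"
begin

text \<open>Matrices indexed by a finite set \<open>S\<close> are functions of two arguments; only the
  entries with both indices in \<open>S\<close> are meaningful.\<close>

definition id_mat :: "'a \<Rightarrow> 'a \<Rightarrow> real" where
  "id_mat x y = (if x = y then 1 else 0)"

definition mat_prod :: "'a set \<Rightarrow> ('a \<Rightarrow> 'a \<Rightarrow> real) \<Rightarrow> ('a \<Rightarrow> 'a \<Rightarrow> real) \<Rightarrow> 'a \<Rightarrow> 'a \<Rightarrow> real" where
  "mat_prod S A B x y = (\<Sum>z\<in>S. A x z * B z y)"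

primrec mat_pow :: "'a set \<Rightarrow> ('a \<Rightarrow> 'a \<Rightarrow> real) \<Rightarrow> nat \<Rightarrow> 'a \<Rightarrow> 'a \<Rightarrow> real" where
  "mat_pow S A 0 = id_mat"
| "mat_pow S A (Suc k) = mat_prod S A (mat_pow S A k)"

definition mat_exp :: "'a set \<Rightarrow> ('a \<Rightarrow> 'a \<Rightarrow> real) \<Rightarrow> 'a \<Rightarrow> 'a \<Rightarrow> real" where
  "mat_exp S A x y = (\<Sum>k. mat_pow S A k x y / fact k)"

record 'a markov_chain =
  states :: "'a set"
  trans_mat :: "'a \<Rightarrow> 'a \<Rightarrow> real"
  stat_dist :: "'a \<Rightarrow> real"

definition ct_kernel :: "'a markov_chain \<Rightarrow> real \<Rightarrow> 'a \<Rightarrow> 'a \<Rightarrow> real" where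
  "ct_kernel C t = mat_exp (states C) (\<lambda>x y. - t * (id_mat x y - trans_mat C x y))"

definition ct_tv_dist :: "'a markov_chain \<Rightarrow> real \<Rightarrow> real" where
  "ct_tv_dist C t =
     (SUP (y, A) \<in> states C \<times> Pow (states C).
        (\<Sum>z\<in>A. ct_kernel C t y z) - (\<Sum>z\<in>A. stat_dist C z))"

text \<open>Families are indexed by \<open>n \<ge> 1\<close>; the value at \<open>0\<close> plays no role.\<close>

definition ct_tv_cutoff :: "(nat \<Rightarrow> 'a markov_chain) \<Rightarrow> bool" where
  "ct_tv_cutoff F \<longleftrightarrow>
     (\<exists>t :: nat \<Rightarrow> real.
        (\<forall>n\<ge>1. t n > 0) \<and>
        (\<forall>a>1. (\<lambda>n. ct_tv_dist (F n) (a * t n)) \<longlonglongrightarrow> 0) \<and>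
        (\<forall>a. 0 < a \<and> a < 1 \<longrightarrow> (\<lambda>n. ct_tv_dist (F n) (a * t n)) \<longlonglongrightarrow> 1))"

text \<open>The product of the chains \<open>C 1, \<dots>, C n\<close>. In \<open>trans_mat\<close>, the \<open>i\<close>-th summand is the
  entry of the tensor product with factor \<open>trans_mat (C i)\<close> in position \<open>i\<close> and the identity
  in every other position.\<close>

definition product_chain ::
  "nat \<Rightarrow> (nat \<Rightarrow> real) \<Rightarrow> (nat \<Rightarrow> 'a markov_chain) \<Rightarrow> (nat \<Rightarrow> 'a) markov_chain" where
  "product_chain n w C =
     \<lparr>states = (\<Pi>\<^sub>E i\<in>{1..n}. states (C i)),
      trans_mat = (\<lambda>x y. \<Sum>i=1..n. w i *
         (\<Prod>j=1..n. if j = i then trans_mat (C j) (x j) (y j) else id_mat (x j) (y j))),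
      stat_dist = (\<lambda>x. \<Prod>i=1..n. stat_dist (C i) (x i))\<rparr>"

text \<open>Simple random walk on the integers modulo \<open>m\<close>, represented by \<open>0, \<dots>, m - 1\<close>. The two
  contributions are added because for \<open>m = 2\<close> both steps lead to the same state.\<close>

definition cycle_walk :: "nat \<Rightarrow> int markov_chain" where
  "cycle_walk m =
     \<lparr>states = {0..<int m},
      trans_mat = (\<lambda>x y. (if y = (x + 1) mod int m then 1/2 else 0) +
                         (if y = (x - 1) mod int m then 1/2 else 0)),
      stat_dist = (\<lambda>x. 1 / real m)\<rparr>"

definition cycle_weight :: "real \<Rightarrow> nat \<Rightarrow> real" where
  "cycle_weight \<gamma> n = (real n)\<^sup>2 * exp (- (real n powr \<gamma>))"

definition cycle_product_family :: "real \<Rightarrow> nat \<Rightarrow> (nat \<Rightarrow> int) markov_chain" where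
  "cycle_product_family \<gamma> n =
     product_chain n (\<lambda>i. cycle_weight \<gamma> i / (\<Sum>j=1..n. cycle_weight \<gamma> j))
       (\<lambda>i. cycle_walk (i + 1))"

end

theory Submission
  imports Defs "HOL-Analysis.Convex" "HOL-Analysis.Infinite_Products"
begin

text \<open>
  The last coordinate of the product is so much slower than all others that, on its own time
  scale, the others are close to equilibrium; and a random walk on a cycle has no cutoff.

  In continuous time the coordinates of the product chain are independent, coordinate \<open>i\<close> being run
  for time \<open>t * w i\<close> (lemma \<open>product_chain_kernel\<close>). With \<open>q\<^sub>n\<close> the sum of the weights and
  \<open>t = s * q\<^sub>n * exp (n powr \<gamma>)\<close> this time is \<open>s * i\<^sup>2 * exp (n powr \<gamma> - i powr \<gamma>)\<close>. The walk on
  the cycle of length \<open>i + 1\<close> mixes in time of order \<open>i\<^sup>2\<close>, so the last coordinate is at \<open>s\<close> times its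
  mixing scale, while coordinate \<open>i < n\<close> is ahead of it by a factor of at least \<open>exp (n - i)\<close>.

  Two bounds hold uniformly in \<open>n\<close>. The lowest Fourier mode of the last coordinate keeps the
  total variation distance above \<open>exp (- 2 * pi\<^sup>2 * s) / 2\<close> (lemma \<open>cycle_family_tv_ge\<close>). On the other
  hand, a Fourier series shows that the density of coordinate \<open>i\<close> differs from \<open>1\<close> by at most
  \<open>(2 / s) * exp (- (n - i))\<close>, and summing over \<open>i\<close> gives a distance of at most \<open>exp (4 / s) - 1\<close>
  (lemma \<open>cycle_family_tv_le\<close>).

  If \<open>t n\<close> were cutoff times, then convergence to \<open>0\<close> at \<open>2 * t n\<close> and the lower bound would force
  the corresponding \<open>s\<close> to become large, whereupon the upper bound keeps the distance at
  \<open>t n / 2\<close> away from \<open>1\<close>.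
\<close>

section \<open>Matrix exponentials and eigenfunctions\<close>

lemma id_mat_mult_left:
  assumes "finite S" "x \<in> S"
  shows "(\<Sum>z\<in>S. id_mat x z * f z) = f x"
proof -
  have "(\<Sum>z\<in>S. id_mat x z * f z) = (\<Sum>z\<in>S. if x = z then f z else 0)"
    by (intro sum.cong) (auto simp: id_mat_def)
  then show ?thesis using assms by simp
qed

lemma id_mat_mult_right:
  assumes "finite S" "y \<in> S"
  shows "(\<Sum>z\<in>S. f z * id_mat z y) = f y"
  using id_mat_mult_left[OF assms, of f] by (simp add: id_mat_def mult.commute eq_commute)

lemma mat_pow_entry_bound:
  assumes "finite S" "\<And>x y. x \<in> S \<Longrightarrow> y \<in> S \<Longrightarrow> \<bar>A x y\<bar> \<le> M"
    and "x \<in> S" "y \<in> S"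
  shows "\<bar>mat_pow S A k x y\<bar> \<le> (real (card S) * M) ^ k"
  using assms(3)
proof (induction k arbitrary: x)
  case 0
  then show ?case by (simp add: id_mat_def)
next
  case (Suc k)
  have "M \<ge> 0" using assms(2)[OF Suc.prems Suc.prems] by linarith
  have "\<bar>mat_pow S A (Suc k) x y\<bar> \<le> (\<Sum>z\<in>S. \<bar>A x z\<bar> * \<bar>mat_pow S A k z y\<bar>)"
    by (simp add: mat_prod_def flip: abs_mult)
  also have "\<dots> \<le> (\<Sum>z\<in>S. M * (real (card S) * M) ^ k)"
    using Suc \<open>M \<ge> 0\<close> assms(2) by (intro sum_mono mult_mono) auto
  finally show ?case by simp
qed

lemma mat_exp_summable:
  assumes "finite S" "x \<in> S" "y \<in> S"
  shows "summable (\<lambda>k. mat_pow S A k x y / fact k)"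
proof -
  define M where "M = (\<Sum>u\<in>S. \<Sum>v\<in>S. \<bar>A u v\<bar>)"
  have M: "\<bar>A u v\<bar> \<le> M" if "u \<in> S" "v \<in> S" for u v
  proof -
    have "\<bar>A u v\<bar> \<le> (\<Sum>v\<in>S. \<bar>A u v\<bar>)"
      using that assms(1) by (intro member_le_sum) auto
    also have "\<dots> \<le> M"
      unfolding M_def using that assms(1)
      by (intro member_le_sum[where f = "\<lambda>u. \<Sum>v\<in>S. \<bar>A u v\<bar>"]) (auto intro: sum_nonneg)
    finally show ?thesis .
  qed
  have "summable (\<lambda>k. inverse (fact k) * (real (card S) * M) ^ k)"
    by (rule summable_exp)
  then show ?thesis
  proof (rule summable_comparison_test')
    show "norm (mat_pow S A k x y / fact k) \<le> inverse (fact k) * (real (card S) * M) ^ k"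
      if "k \<ge> 0" for k
      using mat_pow_entry_bound[of S A M x y k] M assms
      by (simp add: abs_divide field_simps)
  qed
qed

text \<open>The exponential series may be applied to an eigenfunction term by term: the sum over the finite
state space commutes with the absolutely convergent series.\<close>

lemma mat_exp_eigenfunction:
  assumes S: "finite S" and "\<And>x. x \<in> S \<Longrightarrow> (\<Sum>z\<in>S. A x z * f z) = \<mu> * f x"
    and x: "x \<in> S"
  shows "(\<Sum>z\<in>S. mat_exp S A x z * f z) = exp \<mu> * f x"
proof -
  have pow: "(\<Sum>z\<in>S. mat_pow S A k x z * f z) = \<mu> ^ k * f x" for k
    using x
  proof (induction k arbitrary: x)
    case 0
    then show ?case using S by (simp add: id_mat_mult_left)
  next
    case (Suc k)
    have "(\<Sum>z\<in>S. mat_pow S A (Suc k) x z * f z)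
        = (\<Sum>u\<in>S. A x u * (\<Sum>z\<in>S. mat_pow S A k u z * f z))"
      by (simp add: mat_prod_def sum_distrib_right sum_distrib_left mult.assoc) (rule sum.swap)
    also have "\<dots> = (\<Sum>u\<in>S. \<mu> ^ k * (A x u * f u))"
      using Suc.IH by (intro sum.cong) simp_all
    also have "\<dots> = \<mu> ^ Suc k * f x"
      using assms(2)[OF Suc.prems] by (simp flip: sum_distrib_left)
    finally show ?case .
  qed
  have "(\<Sum>z\<in>S. mat_exp S A x z * f z) = (\<Sum>z\<in>S. \<Sum>k. mat_pow S A k x z / fact k * f z)"
    unfolding mat_exp_def using mat_exp_summable[OF S x]
    by (intro sum.cong refl suminf_mult2)
  also have "\<dots> = (\<Sum>k. \<Sum>z\<in>S. mat_pow S A k x z / fact k * f z)"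
    using mat_exp_summable[OF S x] by (intro suminf_sum[symmetric] summable_mult2)
  also have "\<dots> = (\<Sum>k. \<mu> ^ k /\<^sub>R fact k * f x)"
  proof -
    have "(\<Sum>z\<in>S. mat_pow S A k x z / fact k * f z) = \<mu> ^ k /\<^sub>R fact k * f x" for k
    proof -
      have "(\<Sum>z\<in>S. mat_pow S A k x z / fact k * f z) 
         = (\<Sum>z\<in>S. mat_pow S A k x z * f z) / fact k"
        by (simp add: sum_divide_distrib)
      then show ?thesis by (simp only: pow) (simp add: field_simps)
    qed
    then show ?thesis by simp
  qed
  also have "\<dots> = exp \<mu> * f x"
    unfolding exp_def by (rule suminf_mult2[symmetric]) (rule summable_exp_generic)
  finally show ?thesis .
qed

lemma ct_kernel_eigenfunction:
  assumes "finite (states C)"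
    and "\<And>x. x \<in> states C \<Longrightarrow> (\<Sum>z\<in>states C. trans_mat C x z * f z) = \<mu> * f x"
    and "x \<in> states C"
  shows "(\<Sum>z\<in>states C. ct_kernel C t x z * f z) = exp (- t * (1 - \<mu>)) * f x"
  unfolding ct_kernel_def
proof (rule mat_exp_eigenfunction)
  fix x assume x: "x \<in> states C"
  have "(\<Sum>z\<in>states C. - t * (id_mat x z - trans_mat C x z) * f z)
      = - t * ((\<Sum>z\<in>states C. id_mat x z * f z) - (\<Sum>z\<in>states C. trans_mat C x z * f z))"
    unfolding sum_subtractf[symmetric] sum_distrib_left by (intro sum.cong refl) algebra
  also have "(\<Sum>z\<in>states C. id_mat x z * f z) = f x"
    using assms(1) x by (rule id_mat_mult_left)
  finally show "(\<Sum>z\<in>states C. - t * (id_mat x z - trans_mat C x z) * f z) = - t * (1 - \<mu>) * f x"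
    using assms(2)[OF x] by (simp add: algebra_simps)
qed (use assms in auto)

text \<open>The column \<open>y\<close> of the kernel is the semigroup applied to the point mass at \<open>y\<close>, so only that point
mass has to be decomposed. The eigenfunctions may therefore depend on \<open>y\<close>, which lets real cosines
centred at \<open>y\<close> replace complex characters later on.\<close>

lemma ct_kernel_expansion:
  assumes fin: "finite (states C)" and xy: "x \<in> states C" "y \<in> states C"
    and delta: "\<And>z. z \<in> states C \<Longrightarrow> id_mat z y = (\<Sum>j\<in>J. \<phi> j z)"
    and eig: "\<And>j z. j \<in> J \<Longrightarrow> z \<in> states C \<Longrightarrow>
      (\<Sum>u\<in>states C. trans_mat C z u * \<phi> j u) = \<mu> j * \<phi> j z"
  shows "ct_kernel C t x y = (\<Sum>j\<in>J. exp (- t * (1 - \<mu> j)) * \<phi> j x)"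
proof -
  have "ct_kernel C t x y = (\<Sum>z\<in>states C. ct_kernel C t x z * id_mat z y)"
    using id_mat_mult_right[OF fin xy(2)] by simp
  also have "\<dots> = (\<Sum>z\<in>states C. \<Sum>j\<in>J. ct_kernel C t x z * \<phi> j z)"
    using delta by (simp add: sum_distrib_left)
  also have "\<dots> = (\<Sum>j\<in>J. \<Sum>z\<in>states C. ct_kernel C t x z * \<phi> j z)"
    by (rule sum.swap)
  also have "\<dots> = (\<Sum>j\<in>J. exp (- t * (1 - \<mu> j)) * \<phi> j x)"
    using eig by (intro sum.cong refl ct_kernel_eigenfunction[OF fin _ xy(1)])
  finally show ?thesis .
qed

section \<open>Product chains\<close>

text \<open>The \<open>i\<close>-th summand of the transition matrix moves only coordinate \<open>i\<close>, so a tensor product of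
eigenfunctions is merely multiplied by the \<open>i\<close>-th eigenvalue; the eigenvalues are averaged with
the weights.\<close>

lemma product_chain_eigenfunction:
  assumes fin: "\<And>i. i \<in> {1..n} \<Longrightarrow> finite (states (C i))"
    and eig: "\<And>i x. i \<in> {1..n} \<Longrightarrow> x \<in> states (C i) \<Longrightarrow>
      (\<Sum>z\<in>states (C i). trans_mat (C i) x z * g i z) = \<mu> i * g i x"
    and x: "x \<in> states (product_chain n w C)"
  shows "(\<Sum>z\<in>states (product_chain n w C).
            trans_mat (product_chain n w C) x z * (\<Prod>i=1..n. g i (z i)))
       = (\<Sum>i=1..n. w i * \<mu> i) * (\<Prod>i=1..n. g i (x i))"
proof -
  let ?S = "\<Pi>\<^sub>E i\<in>{1..n}. states (C i)"
  let ?T = "\<lambda>i j u v. if j = i then trans_mat (C j) u v else id_mat u v"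
  have xi: "x j \<in> states (C j)" if "j \<in> {1..n}" for j
    using x that by (auto simp: product_chain_def)
  have summand: "(\<Sum>z\<in>?S. (\<Prod>j=1..n. ?T i j (x j) (z j)) * (\<Prod>j=1..n. g j (z j)))
      = \<mu> i * (\<Prod>j=1..n. g j (x j))" if i: "i \<in> {1..n}" for i
  proof -
    have "(\<Sum>z\<in>?S. (\<Prod>j=1..n. ?T i j (x j) (z j)) * (\<Prod>j=1..n. g j (z j)))
        = (\<Sum>z\<in>?S. \<Prod>j=1..n. ?T i j (x j) (z j) * g j (z j))"
      by (simp add: prod.distrib)
    also have "\<dots> = (\<Prod>j=1..n. \<Sum>u\<in>states (C j). ?T i j (x j) u * g j u)"
      by (rule prod_sum_PiE[symmetric]) (use fin in auto)
    also have "\<dots> = (\<Prod>j=1..n. (if j = i then \<mu> j else 1) * g j (x j))"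
    proof (rule prod.cong[OF refl])
      fix j assume j: "j \<in> {1..n}"
      show "(\<Sum>u\<in>states (C j). ?T i j (x j) u * g j u) = (if j = i then \<mu> j else 1) * g j (x j)"
        using eig[OF j xi[OF j]] id_mat_mult_left[OF fin[OF j] xi[OF j]] by (cases "j = i") simp_all
    qed
    also have "\<dots> = \<mu> i * (\<Prod>j=1..n. g j (x j))"
      using i by (simp add: prod.distrib prod.delta)
    finally show ?thesis .
  qed
  have "(\<Sum>z\<in>?S. (\<Sum>i=1..n. w i * (\<Prod>j=1..n. ?T i j (x j) (z j))) * (\<Prod>i=1..n. g i (z i)))
     = (\<Sum>i=1..n. w i * (\<Sum>z\<in>?S. (\<Prod>j=1..n. ?T i j (x j) (z j)) * (\<Prod>j=1..n. g j (z j))))"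
    by (simp add: sum_distrib_right sum_distrib_left mult.assoc) (rule sum.swap)
  also have "\<dots> = (\<Sum>i=1..n. w i * (\<mu> i * (\<Prod>j=1..n. g j (x j))))"
    using summand by (intro sum.cong refl) simp
  finally show ?thesis
    by (simp add: product_chain_def sum_distrib_right mult.assoc)
qed

lemma finite_states_product_chain:
  assumes "\<And>i. i \<in> {1..n} \<Longrightarrow> finite (states (C i))"
  shows "finite (states (product_chain n w C))"
  using assms by (auto simp: product_chain_def intro: finite_PiE)

lemma id_mat_PiE:
  assumes "finite I" "x \<in> PiE I X" "y \<in> PiE I X"
  shows "id_mat x y = (\<Prod>i\<in>I. id_mat (x i) (y i))"
proof (cases "x = y")
  case False
  then obtain i where "i \<in> I" "x i \<noteq> y i"
    using PiE_ext[OF assms(2,3)] by blast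
  then have "(\<Prod>i\<in>I. id_mat (x i) (y i)) = 0"
    using assms(1) by (intro prod_zero) (auto simp: id_mat_def)
  then show ?thesis using False by (simp add: id_mat_def)
qed (simp add: id_mat_def)

text \<open>In continuous time the coordinates evolve independently, the \<open>i\<close>-th one at speed \<open>w i\<close>. On the
spectral side this is the fact that \<open>1\<close> minus a weighted average of eigenvalues is the weighted
average of the gaps, because the weights sum to \<open>1\<close>; the exponential then factorises and the
sum over tuples of eigenfunctions becomes a product of sums. The factor for coordinate \<open>i\<close> is
the spectral expansion of the kernel of \<open>C i\<close> at time \<open>t * w i\<close>.\<close>

lemma product_chain_kernel:
  assumes fin: "\<And>i. i \<in> {1..n} \<Longrightarrow> finite (states (C i))"
    and finJ: "\<And>i. i \<in> {1..n} \<Longrightarrow> finite (J i)"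
    and w: "(\<Sum>i=1..n. w i) = 1"
    and xy: "x \<in> states (product_chain n w C)" "y \<in> states (product_chain n w C)"
    and delta: "\<And>i z. i \<in> {1..n} \<Longrightarrow> z \<in> states (C i) \<Longrightarrow> id_mat z (y i) = (\<Sum>j\<in>J i. \<phi> i j z)"
    and eig: "\<And>i j z. i \<in> {1..n} \<Longrightarrow> j \<in> J i \<Longrightarrow> z \<in> states (C i) \<Longrightarrow>
      (\<Sum>u\<in>states (C i). trans_mat (C i) z u * \<phi> i j u) = \<mu> i j * \<phi> i j z"
  shows "ct_kernel (product_chain n w C) t x y
       = (\<Prod>i=1..n. \<Sum>j\<in>J i. exp (- (t * w i) * (1 - \<mu> i j)) * \<phi> i j (x i))"
proof -
  let ?P = "product_chain n w C" and ?K = "\<Pi>\<^sub>E i\<in>{1..n}. J i"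
  have "ct_kernel ?P t x y
      = (\<Sum>k\<in>?K. exp (- t * (1 - (\<Sum>i=1..n. w i * \<mu> i (k i)))) * (\<Prod>i=1..n. \<phi> i (k i) (x i)))"
  proof (rule ct_kernel_expansion[OF finite_states_product_chain[OF fin] xy])
    fix z assume z: "z \<in> states ?P"
    have "id_mat z y = (\<Prod>i=1..n. id_mat (z i) (y i))"
      using z xy by (intro id_mat_PiE) (auto simp: product_chain_def)
    also have "\<dots> = (\<Prod>i=1..n. \<Sum>j\<in>J i. \<phi> i j (z i))"
      using z by (intro prod.cong refl delta) (auto simp: product_chain_def)
    also have "\<dots> = (\<Sum>k\<in>?K. \<Prod>i=1..n. \<phi> i (k i) (z i))"
      by (rule prod_sum_PiE) (use finJ in auto)
    finally show "id_mat z y = (\<Sum>k\<in>?K. \<Prod>i=1..n. \<phi> i (k i) (z i))" .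
  next
    fix k z assume "k \<in> ?K" "z \<in> states ?P"
    then show "(\<Sum>u\<in>states ?P. trans_mat ?P z u * (\<Prod>i=1..n. \<phi> i (k i) (u i)))
        = (\<Sum>i=1..n. w i * \<mu> i (k i)) * (\<Prod>i=1..n. \<phi> i (k i) (z i))"
      by (intro product_chain_eigenfunction[where g = "\<lambda>i. \<phi> i (k i)"] fin eig) auto
  qed
  also have "\<dots> = (\<Sum>k\<in>?K. \<Prod>i=1..n. exp (- (t * w i) * (1 - \<mu> i (k i))) * \<phi> i (k i) (x i))"
  proof (rule sum.cong[OF refl])
    fix k
    have "- t * (1 - (\<Sum>i=1..n. w i * \<mu> i (k i)))
        = - t * ((\<Sum>i=1..n. w i) - (\<Sum>i=1..n. w i * \<mu> i (k i)))"
      by (simp only: w)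
    also have "\<dots> = (\<Sum>i=1..n. - (t * w i) * (1 - \<mu> i (k i)))"
      unfolding sum_subtractf[symmetric] sum_distrib_left by (intro sum.cong refl) algebra
    finally have "- t * (1 - (\<Sum>i=1..n. w i * \<mu> i (k i)))
        = (\<Sum>i=1..n. - (t * w i) * (1 - \<mu> i (k i)))" .
    then show "exp (- t * (1 - (\<Sum>i=1..n. w i * \<mu> i (k i)))) * (\<Prod>i=1..n. \<phi> i (k i) (x i))
        = (\<Prod>i=1..n. exp (- (t * w i) * (1 - \<mu> i (k i))) * \<phi> i (k i) (x i))"
      by (simp only: exp_sum[OF finite_atLeastAtMost] prod.distrib)
  qed
  also have "\<dots> = (\<Prod>i=1..n. \<Sum>j\<in>J i. exp (- (t * w i) * (1 - \<mu> i j)) * \<phi> i j (x i))"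
    by (rule prod_sum_PiE[symmetric]) (use finJ in auto)
  finally show ?thesis .
qed

section \<open>Total variation\<close>

lemma ct_tv_dist_ge:
  assumes "finite (states C)" "x \<in> states C" "A \<subseteq> states C"
  shows "(\<Sum>z\<in>A. ct_kernel C t x z) - (\<Sum>z\<in>A. stat_dist C z) \<le> ct_tv_dist C t"
proof -
  let ?F = "\<lambda>(y, A). (\<Sum>z\<in>A. ct_kernel C t y z) - (\<Sum>z\<in>A. stat_dist C z)"
  have "?F (x, A) \<le> (SUP p\<in>states C \<times> Pow (states C). ?F p)"
    using assms by (intro cSUP_upper bdd_above_finite) auto
  then show ?thesis by (simp add: ct_tv_dist_def)
qed

lemma ct_tv_dist_le:
  assumes ne: "states C \<noteq> {}" and "finite (states C)"
    and close: "\<And>x z. x \<in> states C \<Longrightarrow> z \<in> states C \<Longrightarrow>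
      \<bar>ct_kernel C t x z - stat_dist C z\<bar> \<le> \<delta> * stat_dist C z"
    and mass: "(\<Sum>z\<in>states C. stat_dist C z) = 1"
  shows "ct_tv_dist C t \<le> \<delta>"
  unfolding ct_tv_dist_def
proof (rule cSUP_least)
  fix p assume p: "p \<in> states C \<times> Pow (states C)"
  obtain x A where [simp]: "p = (x, A)" by (cases p)
  have x: "x \<in> states C" "A \<subseteq> states C" using p by auto
  have "(\<Sum>z\<in>A. ct_kernel C t x z) - (\<Sum>z\<in>A. stat_dist C z)
      = (\<Sum>z\<in>A. ct_kernel C t x z - stat_dist C z)"
    by (simp add: sum_subtractf)
  also have "\<dots> \<le> (\<Sum>z\<in>A. \<delta> * stat_dist C z)"
    using close x by (intro sum_mono) (use abs_le_D1 in blast)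
  also have "\<dots> \<le> (\<Sum>z\<in>states C. \<delta> * stat_dist C z)"
    using x assms(2) close[OF x(1)] by (intro sum_mono2) (auto intro: order_trans[OF abs_ge_zero])
  also have "\<dots> = \<delta>" using mass by (simp flip: sum_distrib_left)
  finally show "(case p of (y, A) \<Rightarrow> (\<Sum>z\<in>A. ct_kernel C t y z) - (\<Sum>z\<in>A. stat_dist C z)) \<le> \<delta>"
    by simp
qed (use ne in auto)

text \<open>An eigenfunction of mean zero still has value \<open>exp (- t * (1 - \<mu>)) * f x\<close> under the law at time
\<open>t\<close>. The signed difference \<open>D\<close> of the two laws has total mass zero, so its \<open>L\<^sup>1\<close> norm is twice
its mass on the set where it is nonnegative, and a test function bounded by \<open>1\<close> cannot detect more than
that norm.\<close>

lemma ct_tv_dist_ge_eigenfunction: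
  assumes fin: "finite (states C)" and x: "x \<in> states C"
    and stoch: "\<And>z. z \<in> states C \<Longrightarrow> (\<Sum>u\<in>states C. trans_mat C z u) = 1"
    and mass: "(\<Sum>z\<in>states C. stat_dist C z) = 1"
    and eig: "\<And>z. z \<in> states C \<Longrightarrow> (\<Sum>u\<in>states C. trans_mat C z u * f u) = \<mu> * f z"
    and orth: "(\<Sum>z\<in>states C. stat_dist C z * f z) = 0"
    and le1: "\<And>z. z \<in> states C \<Longrightarrow> \<bar>f z\<bar> \<le> 1"
  shows "exp (- t * (1 - \<mu>)) * \<bar>f x\<bar> / 2 \<le> ct_tv_dist C t"
proof -
  define D where "D z = ct_kernel C t x z - stat_dist C z" for z
  define A where "A = {z \<in> states C. D z \<ge> 0}"
  have "(\<Sum>z\<in>states C. ct_kernel C t x z) = 1"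
    using ct_kernel_eigenfunction[of C "\<lambda>_. 1" 1 x t] fin x stoch by simp
  then have D0: "(\<Sum>z\<in>states C. D z) = 0"
    using mass by (simp add: D_def sum_subtractf)
  have "exp (- t * (1 - \<mu>)) * f x = (\<Sum>z\<in>states C. D z * f z)"
    using ct_kernel_eigenfunction[OF fin eig x] orth
    by (simp add: D_def left_diff_distrib sum_subtractf)
  then have "exp (- t * (1 - \<mu>)) * \<bar>f x\<bar> = \<bar>\<Sum>z\<in>states C. D z * f z\<bar>"
    by (simp add: abs_mult flip: \<open>exp _ * f x = _\<close>)
  also have "\<dots> \<le> (\<Sum>z\<in>states C. \<bar>D z\<bar>)"
  proof (rule order_trans[OF sum_abs sum_mono])
    fix z assume "z \<in> states C"
    then show "\<bar>D z * f z\<bar> \<le> \<bar>D z\<bar>"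
      using mult_left_mono[OF le1[of z], of "\<bar>D z\<bar>"] by (simp add: abs_mult)
  qed
  also have "\<dots> = (\<Sum>z\<in>states C. 2 * (if D z \<ge> 0 then D z else 0) - D z)"
    by (intro sum.cong) auto
  also have "\<dots> = 2 * (\<Sum>z\<in>A. D z)"
    using fin D0 by (simp add: A_def sum_subtractf sum.inter_filter flip: sum_distrib_left)
  also have "(\<Sum>z\<in>A. D z) \<le> ct_tv_dist C t"
    using ct_tv_dist_ge[OF fin x, of A t] by (simp add: A_def D_def sum_subtractf)
  finally show ?thesis by simp
qed

section \<open>Random walk on a cycle\<close>

lemma states_cycle_walk [simp]: "states (cycle_walk m) = {0..<int m}"
  by (simp add: cycle_walk_def)

lemma stat_dist_cycle_walk [simp]: "stat_dist (cycle_walk m) x = 1 / real m"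
  by (simp add: cycle_walk_def)

text \<open>As a function of the displacement \<open>d\<close>, this is the real part of the \<open>k\<close>-th character of the
integers modulo \<open>m\<close>. It doubles as an eigenvalue: the value at \<open>d = 1\<close> is the eigenvalue of the
walk for frequency \<open>k\<close>.\<close>

definition cycle_wave :: "nat \<Rightarrow> nat \<Rightarrow> int \<Rightarrow> real" where
  "cycle_wave m k d = cos (2 * pi * real k * of_int d / real m)"

lemma cycle_wave_0 [simp]: "cycle_wave m 0 d = 1" "cycle_wave m k 0 = 1"
  by (simp_all add: cycle_wave_def)

lemma abs_cycle_wave_le_1: "\<bar>cycle_wave m k d\<bar> \<le> 1"
  by (simp add: cycle_wave_def)

lemma cycle_wave_mod:
  assumes "m > 0"
  shows "cycle_wave m k (a mod int m - y) = cycle_wave m k (a - y)"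
proof -
  have a: "a mod int m - y = (a - y) - int m * (a div int m)"
    by (simp add: minus_mult_div_eq_mod[symmetric])
  have "2 * pi * real k * of_int (a mod int m - y) / real m
      = 2 * pi * real k * of_int (a - y) / real m - 2 * pi * of_int (int k * (a div int m))"
    unfolding a using assms by (simp add: field_simps)
  then show ?thesis
    unfolding cycle_wave_def by (simp only: cos_diff cos_int_2pin sin_int_2pin)
qed

lemma cycle_walk_eigenfunction:
  assumes "m > 0"
  shows "(\<Sum>z\<in>states (cycle_walk m). trans_mat (cycle_walk m) x z * cycle_wave m k (z - y))
    = cycle_wave m k 1 * cycle_wave m k (x - y)"
proof -
  have mem: "a mod int m \<in> {0..<int m}" for a using assms by simp
  have "(\<Sum>z\<in>{0..<int m}. trans_mat (cycle_walk m) x z * cycle_wave m k (z - y))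
    = (\<Sum>z\<in>{0..<int m}. (if z = (x + 1) mod int m then cycle_wave m k (z - y) / 2 else 0)
       + (if z = (x - 1) mod int m then cycle_wave m k (z - y) / 2 else 0))"
    by (intro sum.cong refl) (auto simp: cycle_walk_def)
  also have "\<dots> = cycle_wave m k ((x + 1) mod int m - y) / 2 + cycle_wave m k ((x - 1) mod int m - y) / 2"
    using mem by (simp add: sum.distrib)
  also have "\<dots> = cycle_wave m k (x + 1 - y) / 2 + cycle_wave m k (x - 1 - y) / 2"
    using assms by (simp add: cycle_wave_mod)
  also have "\<dots> = cycle_wave m k 1 * cycle_wave m k (x - y)"
  proof -
    define \<theta> where "\<theta> = 2 * pi * real k / real m"
    have "2 * pi * real k * of_int d / real m = \<theta> * of_int d" for d
      by (simp add: \<theta>_def)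
    then have w: "cycle_wave m k d = cos (\<theta> * of_int d)" for d
      by (simp add: cycle_wave_def)
    show ?thesis
      unfolding w cos_times_cos by (simp add: algebra_simps add_divide_distrib)
        (metis cos_minus minus_diff_eq)
  qed
  finally show ?thesis by simp
qed

lemma sum_cos_multiples:
  fixes \<theta> :: real
  shows "2 * sin (\<theta> / 2) * (\<Sum>k<m. cos (real k * \<theta>)) = sin (real m * \<theta> - \<theta> / 2) + sin (\<theta> / 2)"
proof (induction m)
  case (Suc m)
  have "2 * sin (\<theta> / 2) * cos (real m * \<theta>) = sin (real m * \<theta> + \<theta> / 2) - sin (real m * \<theta> - \<theta> / 2)"
    by (simp add: sin_add sin_diff)
  moreover have "real (Suc m) * \<theta> - \<theta> / 2 = real m * \<theta> + \<theta> / 2"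
    by (simp add: algebra_simps)
  ultimately show ?case using Suc by (simp add: algebra_simps)
qed simp

text \<open>Orthogonality of the characters: multiplying by \<open>sin (\<theta> / 2)\<close> telescopes the sum, and the two
boundary terms cancel since \<open>m * \<theta>\<close> is a multiple of \<open>2 * pi\<close>.\<close>

lemma sum_cycle_wave_eq_0:
  assumes "m > 0" "\<not> int m dvd d"
  shows "(\<Sum>k<m. cycle_wave m k d) = 0"
proof -
  define \<theta> where "\<theta> = 2 * pi * of_int d / real m"
  have w: "cycle_wave m k d = cos (real k * \<theta>)" for k
    by (simp add: cycle_wave_def \<theta>_def mult_ac)
  have "\<theta> / 2 = of_int d / real m * pi" by (simp add: \<theta>_def)
  moreover have "of_int d / real m \<notin> \<int>"
  proof
    assume "of_int d / real m \<in> \<int>"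
    then obtain j where "of_int d / real m = real_of_int j" by (auto elim: Ints_cases)
    then have "real_of_int d = real_of_int (int m * j)" using assms(1) by (simp add: field_simps)
    then have "d = int m * j" by (simp only: of_int_eq_iff)
    then show False using assms(2) by simp
  qed
  ultimately have "sin (\<theta> / 2) \<noteq> 0" by (simp only: sin_times_pi_eq_0 not_False_eq_True)
  moreover have "sin (real m * \<theta> - \<theta> / 2) = - sin (\<theta> / 2)"
  proof -
    have "real m * \<theta> = 2 * pi * of_int d" using assms(1) by (simp add: \<theta>_def)
    then show ?thesis by (simp only: sin_diff cos_int_2pin sin_int_2pin)
  qed
  ultimately show ?thesis
    using sum_cos_multiples[of \<theta> m] by (simp add: w)
qed

lemma id_mat_cycle_wave:
  assumes "x \<in> states (cycle_walk m)" "y \<in> states (cycle_walk m)"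
  shows "id_mat x y = (\<Sum>k<m. cycle_wave m k (x - y) / real m)"
proof (cases "x = y")
  case True
  then show ?thesis using assms by (simp add: id_mat_def)
next
  case False
  have "\<not> int m dvd x - y"
  proof
    assume "int m dvd x - y"
    then have "x mod int m = y mod int m" by (simp add: mod_eq_dvd_iff)
    then show False using assms False by simp
  qed
  then show ?thesis
    using False assms sum_cycle_wave_eq_0[of m "x - y"] by (simp add: id_mat_def flip: sum_divide_distrib)
qed

lemma sin_ge_chord:
  fixes x :: real
  assumes "0 \<le> x" "x \<le> 1 / 2"
  shows "2 * x \<le> sin (pi * x)"
proof -
  have "concave_on {0..pi / 2} (sin :: real \<Rightarrow> real)"
    by (rule f''_le0_imp_concave[where f' = cos and f'' = "\<lambda>x. - sin x"])
       (auto intro!: derivative_eq_intros sin_ge_zero)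
  from concave_onD_Icc[OF this, of "2 * x"] assms show ?thesis
    by (simp add: mult_ac)
qed

lemma one_minus_cycle_wave: "1 - cycle_wave m k 1 = 2 * (sin (pi * (real k / real m)))\<^sup>2"
  using cos_double_sin[of "pi * (real k / real m)"] by (simp add: cycle_wave_def mult_ac)

text \<open>The gap is \<open>2 * (sin (pi * k / m))\<^sup>2\<close>, and by concavity the sine lies above its chord up to \<open>pi / 2\<close>;
beyond that point \<open>k\<close> is replaced by \<open>m - k\<close>. Adding the two cases instead of taking the larger
of them gives a form that is easy to sum over \<open>k\<close>.\<close>

lemma cycle_inverse_gap_le:
  assumes "0 < k" "k < m"
  shows "1 / (1 - cycle_wave m k 1) \<le> (real m)\<^sup>2 / 8 * (1 / (real k)\<^sup>2 + 1 / (real (m - k))\<^sup>2)"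
proof -
  define x where "x = real k / real m"
  have x: "0 < x" "x < 1" using assms by (simp_all add: x_def)
  have gap: "1 - cycle_wave m k 1 = 2 * (sin (pi * x))\<^sup>2"
    by (simp add: one_minus_cycle_wave x_def)
  have low: "8 * r\<^sup>2 \<le> 1 - cycle_wave m k 1" if "0 < r" "r \<le> 1 / 2" "sin (pi * x) = sin (pi * r)" for r
    using power_mono[OF sin_ge_chord[of r], of 2] that by (simp add: gap power_mult_distrib)
  have inv: "1 / (1 - cycle_wave m k 1) \<le> 1 / 8 * (1 / r\<^sup>2)"
    if "0 < r" "r \<le> 1 / 2" "sin (pi * x) = sin (pi * r)" for r
  proof -
    have "1 / (1 - cycle_wave m k 1) \<le> 1 / (8 * r\<^sup>2)"
      using low[OF that] that by (intro divide_left_mono mult_pos_pos less_le_trans[OF _ low[OF that]]) auto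
    then show ?thesis by simp
  qed
  have "1 / (1 - cycle_wave m k 1) \<le> 1 / 8 * (1 / x\<^sup>2 + 1 / (1 - x)\<^sup>2)"
  proof (cases "x \<le> 1 / 2")
    case True
    have "1 / 8 * (1 / x\<^sup>2) \<le> 1 / 8 * (1 / x\<^sup>2 + 1 / (1 - x)\<^sup>2)" by simp
    with inv[of x] True x show ?thesis by linarith
  next
    case False
    have "sin (pi * x) = sin (pi * (1 - x))"
      by (simp add: right_diff_distrib sin_diff)
    moreover have "0 < 1 - x" "1 - x \<le> 1 / 2" using False x by auto
    ultimately have "1 / (1 - cycle_wave m k 1) \<le> 1 / 8 * (1 / (1 - x)\<^sup>2)" by (rule inv[rotated 2])
    also have "\<dots> \<le> 1 / 8 * (1 / x\<^sup>2 + 1 / (1 - x)\<^sup>2)" by simp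
    finally show ?thesis .
  qed
  also have "1 - x = real (m - k) / real m" using assms by (simp add: x_def field_simps of_nat_diff)
  finally show ?thesis by (simp add: x_def power_divide algebra_simps)
qed

lemma sum_inverse_squares_le: "(\<Sum>k=1..n. 1 / (real k)\<^sup>2) \<le> 2"
proof -
  have "(\<Sum>k=1..Suc n. 1 / (real k)\<^sup>2) \<le> 2 - 1 / real (Suc n)" for n
  proof (induction n)
    case (Suc n)
    have "1 / (real (Suc (Suc n)))\<^sup>2 \<le> 1 / (real (Suc n) * real (Suc (Suc n)))"
      by (intro divide_left_mono) (auto simp: power2_eq_square intro!: mult_mono)
    also have "\<dots> = 1 / real (Suc n) - 1 / real (Suc (Suc n))"
      by (simp add: field_simps)
    finally show ?case using Suc by simp
  qed simp
  from this[of "n - 1"] show ?thesis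
    by (cases n) (auto intro: order_trans)
qed

text \<open>The heat kernel of the walk at time \<open>u\<close> and displacement \<open>d\<close>, given by its Fourier series.\<close>

definition cycle_heat :: "nat \<Rightarrow> real \<Rightarrow> int \<Rightarrow> real" where
  "cycle_heat m u d = (\<Sum>k<m. exp (- u * (1 - cycle_wave m k 1)) * (cycle_wave m k d / real m))"

text \<open>Every nonconstant frequency contributes at most \<open>exp (- u * g) \<le> 1 / (u * g)\<close>, where \<open>g\<close> is its
gap. This crude polynomial decay on the diffusive time scale \<open>m\<^sup>2\<close> is summable over the coordinates
later on, because their time scales are separated exponentially.\<close>

lemma cycle_heat_near_uniform:
  assumes "m > 0" "u > 0"
  shows "\<bar>real m * cycle_heat m u d - 1\<bar> \<le> (real m)\<^sup>2 / (2 * u)"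
proof -
  have "real m * cycle_heat m u d = (\<Sum>k<m. exp (- u * (1 - cycle_wave m k 1)) * cycle_wave m k d)"
    using assms(1) by (simp add: cycle_heat_def sum_distrib_left)
  also have "\<dots> = 1 + (\<Sum>k\<in>{1..m - 1}. exp (- u * (1 - cycle_wave m k 1)) * cycle_wave m k d)"
  proof -
    have "{..<m} = insert 0 {1..m - 1}" using assms(1) by auto
    then show ?thesis by simp
  qed
  finally have "\<bar>real m * cycle_heat m u d - 1\<bar>
      \<le> (\<Sum>k\<in>{1..m - 1}. \<bar>exp (- u * (1 - cycle_wave m k 1)) * cycle_wave m k d\<bar>)"
    by (simp add: sum_abs)
  also have "\<dots> \<le> (\<Sum>k\<in>{1..m - 1}. 1 / u * ((real m)\<^sup>2 / 8 * (1 / (real k)\<^sup>2 + 1 / (real (m - k))\<^sup>2)))"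
  proof (rule sum_mono)
    fix k assume "k \<in> {1..m - 1}"
    then have k: "0 < k" "k < m" by auto
    define g where "g = 1 - cycle_wave m k 1"
    have "0 < g"
    proof -
      have "0 < pi * (real k / real m)" "pi * (real k / real m) < pi"
        using k by (simp_all add: field_simps)
      then have "sin (pi * (real k / real m)) > 0" by (rule sin_gt_zero)
      then show ?thesis by (simp add: g_def one_minus_cycle_wave)
    qed
    have "\<bar>exp (- u * g) * cycle_wave m k d\<bar> \<le> exp (- u * g)"
      using mult_left_mono[OF abs_cycle_wave_le_1[of m k d], of "exp (- u * g)"] by (simp add: abs_mult)
    also have "\<dots> \<le> 1 / (u * g)"
    proof -
      have "u * g \<le> exp (u * g)" using exp_ge_add_one_self[of "u * g"] by linarith
      then show ?thesis using \<open>0 < g\<close> assms(2) by (simp add: exp_minus field_simps)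
    qed
    also have "\<dots> = 1 / u * (1 / g)" by simp
    also have "\<dots> \<le> 1 / u * ((real m)\<^sup>2 / 8 * (1 / (real k)\<^sup>2 + 1 / (real (m - k))\<^sup>2))"
      using cycle_inverse_gap_le[OF k] assms(2) by (intro mult_left_mono) (simp_all add: g_def)
    finally show "\<bar>exp (- u * (1 - cycle_wave m k 1)) * cycle_wave m k d\<bar>
        \<le> 1 / u * ((real m)\<^sup>2 / 8 * (1 / (real k)\<^sup>2 + 1 / (real (m - k))\<^sup>2))"
      by (simp add: g_def)
  qed
  also have "\<dots> = 1 / u * ((real m)\<^sup>2 / 8 *
      ((\<Sum>k\<in>{1..m - 1}. 1 / (real k)\<^sup>2) + (\<Sum>k\<in>{1..m - 1}. 1 / (real (m - k))\<^sup>2)))"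
    by (simp only: sum_distrib_left[symmetric] sum.distrib)
  also have "(\<Sum>k\<in>{1..m - 1}. 1 / (real (m - k))\<^sup>2) = (\<Sum>k\<in>{1..m - 1}. 1 / (real k)\<^sup>2)"
    by (rule sum.reindex_bij_witness[of _ "\<lambda>k. m - k" "\<lambda>k. m - k"]) auto
  also have "1 / u * ((real m)\<^sup>2 / 8 * ((\<Sum>k\<in>{1..m - 1}. 1 / (real k)\<^sup>2) + (\<Sum>k\<in>{1..m - 1}. 1 / (real k)\<^sup>2)))
      \<le> 1 / u * ((real m)\<^sup>2 / 8 * (2 + 2))"
    using assms(2) by (intro mult_left_mono add_mono sum_inverse_squares_le) auto
  finally show ?thesis using assms(2) by (simp add: field_simps)
qed

lemma cycle_wave_gap_le: "1 - cycle_wave m 1 1 \<le> 2 * pi\<^sup>2 / (real m)\<^sup>2"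
proof -
  have "1 - cycle_wave m 1 1 = 2 * (sin (pi / real m))\<^sup>2"
    by (simp add: one_minus_cycle_wave)
  also have "(sin (pi / real m))\<^sup>2 \<le> (pi / real m)\<^sup>2"
    using abs_sin_x_le_abs_x[of "pi / real m"] by (simp only: abs_le_square_iff)
  finally show ?thesis by (simp add: power_divide)
qed

section \<open>Products of random walks on cycles\<close>

lemma product_cycle_kernel:
  assumes m: "\<And>i. i \<in> {1..n} \<Longrightarrow> m i > 0"
    and w: "(\<Sum>i=1..n. w i) = 1"
    and xy: "x \<in> states (product_chain n w (\<lambda>i. cycle_walk (m i)))"
            "y \<in> states (product_chain n w (\<lambda>i. cycle_walk (m i)))"
  shows "ct_kernel (product_chain n w (\<lambda>i. cycle_walk (m i))) t x y
       = (\<Prod>i=1..n. cycle_heat (m i) (t * w i) (x i - y i))"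
  unfolding cycle_heat_def
proof (rule product_chain_kernel[where J = "\<lambda>i. {..<m i}" and
    \<phi> = "\<lambda>i k z. cycle_wave (m i) k (z - y i) / real (m i)" and \<mu> = "\<lambda>i k. cycle_wave (m i) k 1"])
  fix i z assume "i \<in> {1..n}" "z \<in> states (cycle_walk (m i))"
  then show "id_mat z (y i) = (\<Sum>k<m i. cycle_wave (m i) k (z - y i) / real (m i))"
    using xy by (intro id_mat_cycle_wave) (auto simp: product_chain_def)
next
  fix i k z assume i: "i \<in> {1..n}"
  show "(\<Sum>u\<in>states (cycle_walk (m i)). trans_mat (cycle_walk (m i)) z u * (cycle_wave (m i) k (u - y i) / real (m i)))
      = cycle_wave (m i) k 1 * (cycle_wave (m i) k (z - y i) / real (m i))"
    using cycle_walk_eigenfunction[OF m[OF i], of z k "y i"]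
    by (simp del: states_cycle_walk flip: sum_divide_distrib)
qed (use w xy in auto)

lemma product_cycle_integral:
  assumes "\<And>i. i \<in> {1..n} \<Longrightarrow> m i > 0"
  shows "(\<Sum>z\<in>states (product_chain n w (\<lambda>i. cycle_walk (m i))).
            stat_dist (product_chain n w (\<lambda>i. cycle_walk (m i))) z * (\<Prod>i=1..n. g i (z i)))
       = (\<Prod>i=1..n. (\<Sum>u\<in>{0..<int (m i)}. g i u) / real (m i))"
proof -
  have "(\<Sum>z\<in>states (product_chain n w (\<lambda>i. cycle_walk (m i))).
            stat_dist (product_chain n w (\<lambda>i. cycle_walk (m i))) z * (\<Prod>i=1..n. g i (z i)))
      = (\<Sum>z\<in>(\<Pi>\<^sub>E i\<in>{1..n}. {0..<int (m i)}). \<Prod>i=1..n. g i (z i) / real (m i))"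
    by (simp add: product_chain_def prod_dividef)
  also have "\<dots> = (\<Prod>i=1..n. \<Sum>u\<in>{0..<int (m i)}. g i u / real (m i))"
    by (rule prod_sum_PiE[symmetric]) auto
  finally show ?thesis by (simp add: sum_divide_distrib)
qed

lemma product_cycle_mass:
  assumes "\<And>i. i \<in> {1..n} \<Longrightarrow> m i > 0"
  shows "(\<Sum>z\<in>states (product_chain n w (\<lambda>i. cycle_walk (m i))).
            stat_dist (product_chain n w (\<lambda>i. cycle_walk (m i))) z) = 1"
proof -
  have "(\<Prod>i=1..n. (\<Sum>u\<in>{0..<int (m i)}. 1) / real (m i)) = (\<Prod>i=1..n. 1 :: real)"
    using assms by (intro prod.cong) auto
  then show ?thesis
    using product_cycle_integral[of n m w "\<lambda>_ _. 1"] assms by simp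
qed

text \<open>The density of the kernel with respect to the stationary distribution is a product of factors
close to \<open>1\<close>; its distance to \<open>1\<close> is controlled by the sum of the errors of the factors.\<close>

lemma product_cycle_tv_le:
  assumes m: "\<And>i. i \<in> {1..n} \<Longrightarrow> m i > 0"
    and w: "(\<Sum>i=1..n. w i) = 1" and pos: "\<And>i. i \<in> {1..n} \<Longrightarrow> t * w i > 0"
  shows "ct_tv_dist (product_chain n w (\<lambda>i. cycle_walk (m i))) t
       \<le> exp (\<Sum>i=1..n. (real (m i))\<^sup>2 / (2 * (t * w i))) - 1"
proof -
  let ?P = "product_chain n w (\<lambda>i. cycle_walk (m i))"
  let ?\<epsilon> = "\<lambda>i. (real (m i))\<^sup>2 / (2 * (t * w i))"
  show ?thesis
  proof (rule ct_tv_dist_le)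
    show "finite (states ?P)" by (rule finite_states_product_chain) simp
    have "(\<lambda>i\<in>{1..n}. 0) \<in> states ?P" using m by (auto simp: product_chain_def)
    then show "states ?P \<noteq> {}" by blast
    show "(\<Sum>z\<in>states ?P. stat_dist ?P z) = 1" by (rule product_cycle_mass[OF m])
    fix x z assume xz: "x \<in> states ?P" "z \<in> states ?P"
    define e where "e i = real (m i) * cycle_heat (m i) (t * w i) (x i - z i) - 1" for i
    have \<nu>: "stat_dist ?P z = (\<Prod>i=1..n. 1 / real (m i))" by (simp add: product_chain_def)
    then have \<nu>_nonneg: "stat_dist ?P z \<ge> 0" by (simp add: prod_nonneg)
    have "ct_kernel ?P t x z = (\<Prod>i=1..n. cycle_heat (m i) (t * w i) (x i - z i))"
      by (rule product_cycle_kernel[OF m w xz])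
    also have "\<dots> = (\<Prod>i=1..n. (1 + e i) * (1 / real (m i)))"
      using m by (intro prod.cong refl) (auto simp: e_def)
    finally have "ct_kernel ?P t x z = (\<Prod>i=1..n. (1 + e i) * (1 / real (m i)))" .
    then have "ct_kernel ?P t x z = (\<Prod>i=1..n. 1 + e i) * stat_dist ?P z"
      by (simp only: \<nu> prod.distrib)
    then have "ct_kernel ?P t x z - stat_dist ?P z = ((\<Prod>i=1..n. 1 + e i) - 1) * stat_dist ?P z"
      by (simp add: left_diff_distrib)
    then have "\<bar>ct_kernel ?P t x z - stat_dist ?P z\<bar> = \<bar>(\<Prod>i=1..n. 1 + e i) - 1\<bar> * stat_dist ?P z"
      using \<nu>_nonneg by (simp only: abs_mult abs_of_nonneg)
    also have "\<bar>(\<Prod>i=1..n. 1 + e i) - 1\<bar> \<le> (\<Prod>i=1..n. 1 + \<bar>e i\<bar>) - 1"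
      using norm_prod_minus1_le_prod_minus1[of e "{1..n}"] by simp
    also have "(\<Prod>i=1..n. 1 + \<bar>e i\<bar>) \<le> (\<Prod>i=1..n. exp (?\<epsilon> i))"
    proof (rule prod_mono)
      fix i assume i: "i \<in> {1..n}"
      have "\<bar>e i\<bar> \<le> ?\<epsilon> i"
        unfolding e_def by (rule cycle_heat_near_uniform[OF m[OF i] pos[OF i]])
      then show "0 \<le> 1 + \<bar>e i\<bar> \<and> 1 + \<bar>e i\<bar> \<le> exp (?\<epsilon> i)"
        using exp_ge_add_one_self[of "?\<epsilon> i"] by linarith
    qed
    also have "(\<Prod>i=1..n. exp (?\<epsilon> i)) = exp (\<Sum>i=1..n. ?\<epsilon> i)"
      by (simp add: exp_sum)
    finally show "\<bar>ct_kernel ?P t x z - stat_dist ?P z\<bar> \<le> (exp (\<Sum>i=1..n. ?\<epsilon> i) - 1) * stat_dist ?P z"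
      using \<nu>_nonneg by (simp add: mult_right_mono)
  qed
qed

text \<open>The whole chain is at least as far from equilibrium as any one coordinate, as seen by the lowest
frequency wave of coordinate \<open>j\<close>. The bound \<open>m j \<ge> 2\<close> makes this wave orthogonal to the
constants.\<close>

lemma product_cycle_tv_ge:
  assumes m: "\<And>i. i \<in> {1..n} \<Longrightarrow> m i > 0"
    and w: "(\<Sum>i=1..n. w i) = 1" and j: "j \<in> {1..n}" and mj: "m j \<ge> 2"
  shows "exp (- (t * w j) * (1 - cycle_wave (m j) 1 1)) / 2
       \<le> ct_tv_dist (product_chain n w (\<lambda>i. cycle_walk (m i))) t"
proof -
  let ?P = "product_chain n w (\<lambda>i. cycle_walk (m i))"
  define k where "k i = (if i = j then 1 else 0 :: nat)" for i
  define f where "f z = (\<Prod>i=1..n. cycle_wave (m i) (k i) (z i))" for z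
  have eig: "(\<Sum>u\<in>states ?P. trans_mat ?P z u * (\<Prod>i=1..n. cycle_wave (m i) (l i) (u i)))
      = (\<Sum>i=1..n. w i * cycle_wave (m i) (l i) 1) * (\<Prod>i=1..n. cycle_wave (m i) (l i) (z i))"
    if "z \<in> states ?P" for z and l :: "nat \<Rightarrow> nat"
    using cycle_walk_eigenfunction[OF m, of _ _ _ 0] that
    by (intro product_chain_eigenfunction[where g = "\<lambda>i. cycle_wave (m i) (l i)"]) auto
  have \<mu>: "1 - (\<Sum>i=1..n. w i * cycle_wave (m i) (k i) 1) = w j * (1 - cycle_wave (m j) 1 1)"
  proof -
    have "1 - (\<Sum>i=1..n. w i * cycle_wave (m i) (k i) 1)
        = (\<Sum>i=1..n. w i) - (\<Sum>i=1..n. w i * cycle_wave (m i) (k i) 1)"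
      by (simp only: w)
    also have "\<dots> = (\<Sum>i=1..n. if i = j then w j * (1 - cycle_wave (m j) 1 1) else 0)"
      unfolding sum_subtractf[symmetric] by (intro sum.cong refl) (auto simp: k_def algebra_simps)
    finally show ?thesis using j by simp
  qed
  let ?o = "\<lambda>i\<in>{1..n}. 0 :: int"
  have "exp (- t * (1 - (\<Sum>i=1..n. w i * cycle_wave (m i) (k i) 1))) * \<bar>f ?o\<bar> / 2 \<le> ct_tv_dist ?P t"
  proof (rule ct_tv_dist_ge_eigenfunction)
    show "finite (states ?P)" by (rule finite_states_product_chain) simp
    show "?o \<in> states ?P" using m by (auto simp: product_chain_def)
    show "(\<Sum>u\<in>states ?P. trans_mat ?P z u) = 1" if "z \<in> states ?P" for z
      using eig[OF that, of "\<lambda>_. 0"] w by simp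
    show "(\<Sum>z\<in>states ?P. stat_dist ?P z) = 1" by (rule product_cycle_mass[OF m])
    show "(\<Sum>u\<in>states ?P. trans_mat ?P z u * f u)
        = (\<Sum>i=1..n. w i * cycle_wave (m i) (k i) 1) * f z" if "z \<in> states ?P" for z
      unfolding f_def by (rule eig[OF that])
    show "\<bar>f z\<bar> \<le> 1" for z
      unfolding f_def abs_prod by (intro prod_le_1) (auto intro: abs_cycle_wave_le_1)
    have "(\<Sum>u\<in>{0..<int (m j)}. cycle_wave (m j) (k j) u) = (\<Sum>u<m j. cycle_wave (m j) u 1)"
      by (rule sum.reindex_bij_witness[of _ int nat]) (auto simp: k_def cycle_wave_def)
    also have "\<dots> = 0" using mj by (intro sum_cycle_wave_eq_0) auto
    finally have "(\<Prod>i=1..n. (\<Sum>u\<in>{0..<int (m i)}. cycle_wave (m i) (k i) u) / real (m i)) = 0"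
      using j by (intro prod_zero bexI[of _ j]) simp_all
    then show "(\<Sum>z\<in>states ?P. stat_dist ?P z * f z) = 0"
      unfolding f_def by (subst product_cycle_integral[OF m]) simp_all
  qed
  moreover have "f ?o = 1" by (simp add: f_def)
  ultimately show ?thesis unfolding \<mu> by (simp add: mult.assoc)
qed

section \<open>The weighted family at its slowest time scale\<close>

lemma cycle_weight_pos: "i \<ge> 1 \<Longrightarrow> cycle_weight \<gamma> i > 0"
  by (simp add: cycle_weight_def)

lemma sum_cycle_weight_pos: "n \<ge> 1 \<Longrightarrow> (\<Sum>i=1..n. cycle_weight \<gamma> i) > 0"
  by (intro sum_pos) (auto simp: cycle_weight_pos)

text \<open>Applied to \<open>x = i\<close> and \<open>y = n\<close>, this makes the time scales of the coordinates at least
geometrically separated. The proof factors \<open>z powr \<gamma> = z powr (\<gamma> - 1) * z\<close>, where the first factor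
is at least \<open>1\<close> and nondecreasing in \<open>z\<close>.\<close>

lemma powr_diff_ge:
  fixes x y \<gamma> :: real
  assumes "\<gamma> \<ge> 1" "1 \<le> x" "x \<le> y"
  shows "y - x \<le> y powr \<gamma> - x powr \<gamma>"
proof -
  have split: "z powr \<gamma> = z powr (\<gamma> - 1) * z" if "z \<ge> 1" for z :: real
    using that powr_add[of z "\<gamma> - 1" 1] by simp
  have "1 * (y - x) \<le> x powr (\<gamma> - 1) * (y - x)"
    using assms by (intro mult_right_mono ge_one_powr_ge_zero) auto
  also have "\<dots> = x powr (\<gamma> - 1) * y - x powr \<gamma>"
    using assms by (simp add: split algebra_simps)
  also have "\<dots> \<le> y powr (\<gamma> - 1) * y - x powr \<gamma>"
    using assms by (intro diff_right_mono mult_right_mono powr_mono2) auto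
  finally show ?thesis using assms by (simp add: split)
qed

text \<open>Time in units of \<open>q\<^sub>n * exp (n powr \<gamma>)\<close>, where \<open>q\<^sub>n\<close> is the sum of the weights. When this clock
shows \<open>s\<close>, coordinate \<open>i\<close> has run for time \<open>s * i\<^sup>2 * exp (n powr \<gamma> - i powr \<gamma>)\<close>: the last one
is at \<open>s\<close> times its diffusive scale \<open>n\<^sup>2\<close>, and all earlier ones are further advanced.\<close>

definition slow_clock :: "real \<Rightarrow> nat \<Rightarrow> real \<Rightarrow> real" where
  "slow_clock \<gamma> n t = t * exp (- (real n powr \<gamma>)) / (\<Sum>j=1..n. cycle_weight \<gamma> j)"

text \<open>On the slow clock the last coordinate alone relaxes at a rate bounded independently of \<open>n\<close>.\<close>

lemma cycle_family_tv_ge: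
  assumes n: "n \<ge> 1" and t: "t \<ge> 0"
  shows "exp (- 2 * pi\<^sup>2 * slow_clock \<gamma> n t) / 2 \<le> ct_tv_dist (cycle_product_family \<gamma> n) t"
proof -
  let ?q = "\<Sum>j=1..n. cycle_weight \<gamma> j" and ?s = "slow_clock \<gamma> n t"
  note q = sum_cycle_weight_pos[OF n, of \<gamma>]
  have "t * (cycle_weight \<gamma> n / ?q) * (1 - cycle_wave (n + 1) 1 1)
      = ?s * ((real n)\<^sup>2 * (1 - cycle_wave (n + 1) 1 1))"
    by (simp add: slow_clock_def cycle_weight_def)
  also have "\<dots> \<le> ?s * (2 * pi\<^sup>2)"
  proof (rule mult_left_mono)
    have "(real n)\<^sup>2 * (1 - cycle_wave (n + 1) 1 1) \<le> (real (n + 1))\<^sup>2 * (1 - cycle_wave (n + 1) 1 1)"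
      using abs_cycle_wave_le_1[of "n + 1" 1 1] by (intro mult_right_mono power_mono) auto
    also have "\<dots> \<le> (real (n + 1))\<^sup>2 * (2 * pi\<^sup>2 / (real (n + 1))\<^sup>2)"
      by (intro mult_left_mono cycle_wave_gap_le) simp
    also have "\<dots> = 2 * pi\<^sup>2" by simp
    finally show "(real n)\<^sup>2 * (1 - cycle_wave (n + 1) 1 1) \<le> 2 * pi\<^sup>2" .
    show "0 \<le> ?s" using t q by (simp add: slow_clock_def)
  qed
  finally have "exp (- 2 * pi\<^sup>2 * ?s) / 2
      \<le> exp (- (t * (cycle_weight \<gamma> n / ?q)) * (1 - cycle_wave (n + 1) 1 1)) / 2"
    by (simp add: mult_ac)
  also have "\<dots> \<le> ct_tv_dist (cycle_product_family \<gamma> n) t"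
    unfolding cycle_product_family_def
    by (rule product_cycle_tv_ge[where j = n and m = "\<lambda>i. i + 1" and w = "\<lambda>i. cycle_weight \<gamma> i / ?q"])
       (use n q in \<open>auto simp flip: sum_divide_distrib\<close>)
  finally show ?thesis .
qed

lemma sum_exp_neg_le_2: "(\<Sum>i=1..n. exp (- (real n - real i))) \<le> 2"
proof (induction n)
  case (Suc n)
  have "(\<Sum>i=1..Suc n. exp (- (real (Suc n) - real i)))
      = exp (-1) * (\<Sum>i=1..n. exp (- (real n - real i))) + 1"
    by (simp add: sum_distrib_left flip: exp_add) (simp add: algebra_simps)
  also have "\<dots> \<le> 1 / 2 * 2 + 1"
  proof -
    have "exp (-1) \<le> (1 / 2 :: real)"
      using exp_ge_add_one_self[of 1] by (simp add: exp_minus field_simps)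
    then show ?thesis using Suc.IH by (intro add_right_mono mult_mono) (auto intro: sum_nonneg)
  qed
  finally show ?case by simp
qed simp

text \<open>The errors of the coordinates on the slow clock are dominated by a geometric series in
\<open>n - i\<close>, whose sum does not depend on \<open>n\<close>. The constant comes from \<open>(i + 1)\<^sup>2 \<le> 4 * i\<^sup>2\<close>.\<close>

lemma cycle_family_tv_le:
  assumes \<gamma>: "\<gamma> \<ge> 1" and n: "n \<ge> 1" and t: "t > 0"
  shows "ct_tv_dist (cycle_product_family \<gamma> n) t \<le> exp (4 / slow_clock \<gamma> n t) - 1"
proof -
  let ?q = "\<Sum>j=1..n. cycle_weight \<gamma> j" and ?s = "slow_clock \<gamma> n t"
  let ?w = "\<lambda>i. cycle_weight \<gamma> i / ?q"
  note q = sum_cycle_weight_pos[OF n, of \<gamma>]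
  have s: "?s > 0" using q t by (simp add: slow_clock_def)
  have tw: "t * ?w i = ?s * (real i)\<^sup>2 * exp (real n powr \<gamma> - real i powr \<gamma>)" for i
    by (simp add: slow_clock_def cycle_weight_def exp_diff exp_minus field_simps)
  have pos: "t * ?w i > 0" if "i \<in> {1..n}" for i
    using that s unfolding tw by simp
  have "(\<Sum>i=1..n. (real (i + 1))\<^sup>2 / (2 * (t * ?w i)))
      \<le> (\<Sum>i=1..n. 2 / ?s * exp (- (real n - real i)))"
  proof (rule sum_mono)
    fix i assume i: "i \<in> {1..n}"
    have "(real (i + 1))\<^sup>2 \<le> (2 * real i)\<^sup>2" using i by (intro power_mono) auto
    then have "(real (i + 1))\<^sup>2 / (2 * (t * ?w i)) \<le> 4 * (real i)\<^sup>2 / (2 * (t * ?w i))"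
      using pos[OF i] by (intro divide_right_mono) (auto simp: power_mult_distrib)
    also have "\<dots> = 2 / ?s * exp (- (real n powr \<gamma> - real i powr \<gamma>))"
      unfolding tw using i s by (simp add: exp_diff field_simps)
    also have "\<dots> \<le> 2 / ?s * exp (- (real n - real i))"
      using powr_diff_ge[OF \<gamma>, of "real i" "real n"] i s by (intro mult_left_mono) auto
    finally show "(real (i + 1))\<^sup>2 / (2 * (t * ?w i)) \<le> 2 / ?s * exp (- (real n - real i))" .
  qed
  also have "\<dots> \<le> 2 / ?s * 2"
    unfolding sum_distrib_left[symmetric] using s by (intro mult_left_mono sum_exp_neg_le_2) auto
  finally have "(\<Sum>i=1..n. (real (i + 1))\<^sup>2 / (2 * (t * ?w i))) \<le> 4 / ?s" by simp
  then have "exp (\<Sum>i=1..n. (real (i + 1))\<^sup>2 / (2 * (t * ?w i))) - 1 \<le> exp (4 / ?s) - 1"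
    by simp
  moreover have "ct_tv_dist (cycle_product_family \<gamma> n) t
      \<le> exp (\<Sum>i=1..n. (real (i + 1))\<^sup>2 / (2 * (t * ?w i))) - 1"
    unfolding cycle_product_family_def
    by (rule product_cycle_tv_le[where m = "\<lambda>i. i + 1" and w = ?w])
       (use pos q in \<open>auto simp flip: sum_divide_distrib\<close>)
  ultimately show ?thesis by linarith
qed

theorem proposition1p4:
  fixes \<gamma> :: real
  assumes "\<gamma> > 0" and "\<gamma> > 1"
  shows "\<not> ct_tv_cutoff (cycle_product_family \<gamma>)"
proof
  let ?d = "\<lambda>n. ct_tv_dist (cycle_product_family \<gamma> n)"
  assume "ct_tv_cutoff (cycle_product_family \<gamma>)"
  then obtain t :: "nat \<Rightarrow> real" where t: "\<And>n. n \<ge> 1 \<Longrightarrow> t n > 0"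
    and above: "\<And>a. a > 1 \<Longrightarrow> (\<lambda>n. ?d n (a * t n)) \<longlonglongrightarrow> 0"
    and below: "\<And>a. 0 < a \<Longrightarrow> a < 1 \<Longrightarrow> (\<lambda>n. ?d n (a * t n)) \<longlonglongrightarrow> 1"
    unfolding ct_tv_cutoff_def by blast
  define s where "s n = slow_clock \<gamma> n (t n)" for n
  have scale: "slow_clock \<gamma> n (a * t n) = a * s n" for a n
    by (simp add: s_def slow_clock_def)
  \<comment> \<open>The threshold is the lower bound for \<open>?d n (2 * t n)\<close> when the slow clock shows \<open>64\<close>.\<close>
  have "\<forall>\<^sub>F n in sequentially. ?d n (2 * t n) < exp (- 128 * pi\<^sup>2) / 2"
    by (rule order_tendstoD(2)[OF above]) simp_all
  moreover have "\<forall>\<^sub>F n in sequentially. ?d n (1 / 2 * t n) > 1 / 2"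
    by (rule order_tendstoD(1)[OF below]) simp_all
  ultimately have "\<forall>\<^sub>F n in sequentially. False"
    using eventually_ge_at_top[of 1]
  proof eventually_elim
    case (elim n)
    have "exp (- 2 * pi\<^sup>2 * (2 * s n)) / 2 \<le> ?d n (2 * t n)"
      using cycle_family_tv_ge[of n "2 * t n" \<gamma>] elim(3) t[of n] by (simp only: scale) simp
    with elim(1) have "exp (- 2 * pi\<^sup>2 * (2 * s n)) < exp (- 128 * pi\<^sup>2)" by linarith
    then have "pi\<^sup>2 * 32 < pi\<^sup>2 * s n" by simp
    then have s: "s n > 32" by simp
    \<comment> \<open>Half of the proposed cutoff time is therefore already late on the slow clock.\<close>
    have "?d n (1 / 2 * t n) \<le> exp (4 / (1 / 2 * s n)) - 1"
      using cycle_family_tv_le[of \<gamma> n "1 / 2 * t n"] assms elim(3) t[of n] by (simp only: scale) simp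
    also have "\<dots> \<le> exp (1 / 4) - 1" using s by (simp add: field_simps)
    also have "\<dots> \<le> 1 / 2" using exp_bound[of "1 / 4"] by (simp add: power2_eq_square)
    finally show False using elim(2) by linarith
  qed
  then show False by simp
qed

end
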